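(* Let $X\in\mathbb{R}^{m\times N}$, $w\in\mathbb{R}^N$, $\lambda>0$ and $\delta>0$. Run OPTQ on $w$ with Hessian $H=X^\top X+\lambda I$ and the infinite alphabet $\mathcal{A}^\delta$. Then the resulting quantized vector $q$ satisfies $$\|Xw-Xq\|_2\le\frac{\sqrt{N}\,\delta}{2}\min\left\{\sqrt{\frac{\operatorname{Tr}(X^\top X)}{N}+\lambda}\ ,\ \|X\|_{\mathrm{op}}\right\}$$ and $$\|w-q\|_2\le\frac{\sqrt{N}\,\delta}{2}\sqrt{\frac{\operatorname{Tr}(X^\top X)}{N\lambda}+1}.$$
   Context: $\|\cdot\|_{\mathrm{op}}$ is the spectral norm. Quantizer: $\mathcal{A}^\delta=\{k\delta:k\in\mathbb{Z}\}$ and $\mathcal{Q}(z)=\arg\min_{p\in\mathcal{A}^\delta}|z-p|$ (round to nearest, ties broken by a fixed rule). OPTQ with an invertible symmetric positive definite Hessian $H\in\mathbb{R}^{N\times N}$, applied to $w\in\mathbb{R}^N$: let $H^{-1}=LL^\top$ be the Cholesky decomposition ($L$ lower triangular). Set $w^{(0)}=w$. For $t=1,\dots,N$: set $q_t=\mathcal{Q}(w^{(t-1)}_t)$ and $w^{(t)}_{\ge t+1}=w^{(t-1)}_{\ge t+1}+(q_t-w^{(t-1)}_t)\,L_{\ge t+1,t}/L_{tt}$, where $v_{\ge j}=(v_j,\dots,v_N)^\top$ and $L_{\ge t+1,t}$ is the part of the $t$-th column of $L$ below the diagonal. The output is $q=(q_1,\dots,q_N)^\top$. *)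

theory Defs
  imports "HOL-Analysis.Analysis"
begin

definition alphabet :: "real \<Rightarrow> real set" where
  "alphabet \<delta> = {of_int k * \<delta> | k :: int. True}"

(* A function Q with this property is rounding to nearest with some fixed tie-breaking rule. *)
definition is_quantizer :: "real \<Rightarrow> (real \<Rightarrow> real) \<Rightarrow> bool" where
  "is_quantizer \<delta> Q \<longleftrightarrow> (\<forall>z. is_arg_min (\<lambda>p. \<bar>z - p\<bar>) (\<lambda>p. p \<in> alphabet \<delta>) (Q z))"

(* The coordinates 1, ..., N are represented by a finite linearly ordered index type with N
   elements; its order is the order in which the coordinates are processed. *)

definition is_cholesky ::
  "real ^ 'n::{finite,linorder} ^ 'n::{finite,linorder} \<Rightarrow> real ^ 'n::{finite,linorder} ^ 'n::{finite,linorder} \<Rightarrow> bool" where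
  "is_cholesky A L \<longleftrightarrow>
     A = L ** transpose L \<and> (\<forall>i j. i < j \<longrightarrow> L $ i $ j = 0) \<and> (\<forall>i. 0 < L $ i $ i)"

(* Meaningful for symmetric positive definite matrices, where the factor exists and is unique. *)
definition cholesky :: "real ^ 'n::{finite,linorder} ^ 'n::{finite,linorder} \<Rightarrow> real ^ 'n::{finite,linorder} ^ 'n::{finite,linorder}" where
  "cholesky A = (THE L. is_cholesky A L)"

(* Counting from 0: nth_index 0 is the first coordinate. *)
definition nth_index :: "nat \<Rightarrow> 'n::{finite,linorder}" where
  "nth_index t = sorted_list_of_set UNIV ! t"

(* optq_iter Q L w t is w^(t). Only the coordinates after the t-th one are used later on; the
   remaining ones are left unchanged. Meaningful for t up to the dimension. *)
primrec optq_iter ::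
  "(real \<Rightarrow> real) \<Rightarrow> real ^ 'n::{finite,linorder} ^ 'n::{finite,linorder} \<Rightarrow> real ^ 'n::{finite,linorder} \<Rightarrow> nat \<Rightarrow> real ^ 'n::{finite,linorder}" where
  "optq_iter Q L w 0 = w"
| "optq_iter Q L w (Suc t) =
     (let i = nth_index t; v = optq_iter Q L w t
      in \<chi> j. if i < j then v $ j + (Q (v $ i) - v $ i) * (L $ j $ i / L $ i $ i) else v $ j)"

(* card {..<i} steps have been made when coordinate i is quantized. *)
definition optq ::
  "(real \<Rightarrow> real) \<Rightarrow> real ^ 'n::{finite,linorder} ^ 'n::{finite,linorder} \<Rightarrow> real ^ 'n::{finite,linorder} \<Rightarrow> real ^ 'n::{finite,linorder}" where
  "optq Q H w = (\<chi> i. Q (optq_iter Q (cholesky (matrix_inv H)) w (card {..<i}) $ i))"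

end

theory Submission
  imports Defs
begin

text \<open>Unrolling the iteration gives \<open>q - w = L e\<close>, where \<open>L\<^sub>j\<^sub>j e\<^sub>j\<close> is the rounding error of step \<open>j\<close>
  and hence at most \<open>\<delta>/2\<close> in modulus. Since \<open>L\<^sup>T H L = I\<close>, the quadratic form of \<open>H\<close> at \<open>q - w\<close> is
  \<open>\<parallel>e\<parallel>\<^sup>2\<close>; and \<open>1 / L\<^sub>j\<^sub>j\<^sup>2 \<le> H\<^sub>j\<^sub>j\<close>, because the \<open>j\<close>-th column of \<open>L\<^sup>-\<^sup>1\<close> has squared norm \<open>H\<^sub>j\<^sub>j\<close>
  and \<open>j\<close>-th entry \<open>1 / L\<^sub>j\<^sub>j\<close>. So \<open>\<parallel>X (w - q)\<parallel>\<^sup>2 + \<lambda> \<parallel>w - q\<parallel>\<^sup>2 \<le> (\<delta>\<^sup>2 / 4) (Tr (X\<^sup>T X) + N \<lambda>)\<close>,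
  which gives the two trace bounds. For the operator norm bound, either \<open>\<parallel>w - q\<parallel> \<le> sqrt N \<delta> / 2\<close> and
  the bound is immediate, or the term \<open>\<lambda> \<parallel>w - q\<parallel>\<^sup>2\<close> absorbs the contribution of \<open>N \<lambda>\<close>.\<close>

section \<open>Induction along the coordinate order and forward substitution\<close>

lemma finite_linorder_less_induct:
  fixes P :: "'n::{finite,linorder} \<Rightarrow> bool"
  assumes "\<And>i. (\<And>j. j < i \<Longrightarrow> P j) \<Longrightarrow> P i"
  shows "P i"
proof (induction "card {..<i}" arbitrary: i rule: less_induct)
  case less
  show ?case
  proof (rule assms)
    fix j assume "j < i"
    then have "{..<j} \<subset> {..<i}" by auto
    then show "P j" by (intro less psubset_card_mono) auto
  qed
qed

text \<open>The shape half of \<open>is_cholesky\<close>, kept apart from the factorization so that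
  forward substitution also serves partially built factors.\<close>

definition lower_triangular_pos :: "real ^ 'n::{finite,linorder} ^ 'n::{finite,linorder} \<Rightarrow> bool" where
  "lower_triangular_pos L \<longleftrightarrow> (\<forall>i j. i < j \<longrightarrow> L $ i $ j = 0) \<and> (\<forall>i. 0 < L $ i $ i)"

lemma is_cholesky_iff:
  "is_cholesky A L \<longleftrightarrow> A = L ** transpose L \<and> lower_triangular_pos L"
  by (simp add: is_cholesky_def lower_triangular_pos_def)

text \<open>Isolates the diagonal term: it is the pivot in forward substitution, and the current
  rounding error in OPTQ, where the strict part is the accumulated correction.\<close>

lemma lower_triangular_mult_nth:
  assumes "lower_triangular_pos L"
  shows "(L *v x) $ j = (\<Sum>i | i < j. L $ j $ i * x $ i) + L $ j $ j * x $ j"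
proof -
  have "(L *v x) $ j = (\<Sum>i\<in>insert j {i. i < j}. L $ j $ i * x $ i)"
    unfolding matrix_vector_mult_def vec_lambda_beta
  proof (rule sum.mono_neutral_right)
    show "\<forall>i\<in>UNIV - insert j {i. i < j}. L $ j $ i * x $ i = 0"
      using assms by (auto simp: lower_triangular_pos_def)
  qed auto
  then show ?thesis by (simp add: add.commute)
qed

text \<open>Once the entries before \<open>k\<close> vanish, row \<open>k\<close> of the product
  reduces to the pivot times \<open>x $ k\<close>, and the pivot is nonzero.\<close>

lemma forward_substitution_zero:
  assumes "lower_triangular_pos L" and "\<And>i. i < j \<Longrightarrow> (L *v x) $ i = 0" and "k < j"
  shows "x $ k = 0"
  using \<open>k < j\<close>
proof (induction k rule: finite_linorder_less_induct)
  case (1 k)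
  then have "(\<Sum>i | i < k. L $ k $ i * x $ i) = 0"
    by (intro sum.neutral) auto
  then have "L $ k $ k * x $ k = 0"
    using lower_triangular_mult_nth[OF assms(1), of x k] assms(2)[OF 1(2)] by simp
  then show ?case
    using assms(1) by (auto simp: lower_triangular_pos_def less_le)
qed

lemma forward_substitution_leading:
  assumes "lower_triangular_pos L" and "\<And>i. i < j \<Longrightarrow> (L *v x) $ i = 0"
  shows "(L *v x) $ j = L $ j $ j * x $ j"
proof -
  have "(\<Sum>i | i < j. L $ j $ i * x $ i) = 0"
    using forward_substitution_zero[OF assms] by (intro sum.neutral) auto
  then show ?thesis using lower_triangular_mult_nth[OF assms(1), of x j] by simp
qed

lemma lower_triangular_invertible:
  assumes "lower_triangular_pos L"
  shows "invertible L"
proof -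
  have "x = 0" if "L *v x = 0" for x
  proof -
    have "L $ j $ j * x $ j = 0" for j
      using forward_substitution_leading[OF assms, of j x] that by simp
    then show "x = 0"
      using assms by (auto simp: lower_triangular_pos_def vec_eq_iff less_le)
  qed
  then show ?thesis
    unfolding invertible_left_inverse using matrix_left_invertible_ker by blast
qed

section \<open>Uniqueness and existence of the Cholesky factor\<close>

lemma invertible_solve:
  fixes A :: "real ^ 'n ^ 'n"
  assumes "invertible A"
  obtains x where "A *v x = b"
  using assms unfolding invertible_right_inverse matrix_right_invertible_surjective
  by (metis surjD)

lemma inner_matrix_vector_mult:
  fixes A :: "real ^ 'n ^ 'm"
  shows "(A *v x) \<bullet> y = x \<bullet> (transpose A *v y)"
  by (metis dot_lmul_matrix vector_transpose_matrix transpose_transpose)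

lemma mult_transpose_nth: "(L ** transpose L) $ i $ j = row i L \<bullet> row j L"
  for L :: "real ^ 'n ^ 'm"
  by (simp add: matrix_matrix_mult_def transpose_def row_def inner_vec_def)

text \<open>Row by row: if all earlier rows agree, the difference of the two \<open>i\<close>-th
  rows is orthogonal to them, so forward substitution kills its entries before \<open>i\<close>.
  Entries after \<open>i\<close> vanish by shape, and equal row norms with positive diagonals settle
  the last one.\<close>

lemma cholesky_unique:
  fixes A L M :: "real ^ 'n::{finite,linorder} ^ 'n::{finite,linorder}"
  assumes "is_cholesky A L" and "is_cholesky A M"
  shows "L = M"
proof -
  have L: "lower_triangular_pos L" and M: "lower_triangular_pos M"
    using assms by (auto simp: is_cholesky_iff)
  have gram: "row i L \<bullet> row j L = row i M \<bullet> row j M" for i j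
    using assms unfolding is_cholesky_iff by (metis mult_transpose_nth)
  have "row i L = row i M" for i
  proof (induction i rule: finite_linorder_less_induct)
    case (1 i)
    let ?v = "row i L - row i M"
    have mult: "(L *v ?v) $ j = 0" if "j < i" for j
    proof -
      have "(L *v ?v) $ j = row j L \<bullet> ?v"
        by (simp add: matrix_vector_mult_def row_def inner_vec_def)
      also have "\<dots> = row i L \<bullet> row j L - row i M \<bullet> row j L"
        by (simp add: inner_diff_right inner_commute)
      also have "row i M \<bullet> row j L = row i M \<bullet> row j M"
        using 1[OF that] by simp
      finally show ?thesis using gram by simp
    qed
    have below: "?v $ k = 0" if "k < i" for k
      using forward_substitution_zero[OF L mult that] .
    have above: "?v $ k = 0" if "i < k" for k
      using L M that by (simp add: lower_triangular_pos_def row_def)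
    have off: "L $ i $ k = M $ i $ k" if "k \<noteq> i" for k
      using below[of k] above[of k] that by (auto simp: row_def neq_iff)
    have sq: "row i K \<bullet> row i K = (K $ i $ i)\<^sup>2 + (\<Sum>k\<in>UNIV - {i}. (K $ i $ k)\<^sup>2)"
      for K :: "real ^ 'n::{finite,linorder} ^ 'n::{finite,linorder}"
      by (simp add: row_def inner_vec_def power2_eq_square sum.remove[of UNIV i])
    have "(\<Sum>k\<in>UNIV - {i}. (L $ i $ k)\<^sup>2) = (\<Sum>k\<in>UNIV - {i}. (M $ i $ k)\<^sup>2)"
      by (rule sum.cong) (auto simp: off)
    then have "(L $ i $ i)\<^sup>2 = (M $ i $ i)\<^sup>2"
      using gram[of i i] by (simp add: sq)
    then have "L $ i $ i = M $ i $ i"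
      using L M by (metis lower_triangular_pos_def less_imp_le power2_eq_imp_eq)
    then have "L $ i $ k = M $ i $ k" for k
      using off by (cases "k = i") simp_all
    then show ?case by (simp add: vec_eq_iff row_def)
  qed
  then show ?thesis by (simp add: vec_eq_iff row_def)
qed

lemma cholesky_exists:
  fixes A :: "real ^ 'n::{finite,linorder} ^ 'n::{finite,linorder}"
  assumes sym: "transpose A = A" and pos: "\<And>x. x \<noteq> 0 \<Longrightarrow> 0 < x \<bullet> (A *v x)"
  shows "\<exists>L. is_cholesky A L"
proof -
  text \<open>Induction on the set \<open>S\<close> of processed indices, with every matrix padded by the
    identity outside \<open>S\<close>, so that the factor stays invertible on the whole space.\<close>
  define B where
    "B S = (\<chi> i j. if i \<in> S \<and> j \<in> S then A $ i $ j else if i = j then 1 else 0)" for S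
  have symA: "A $ i $ j = A $ j $ i" for i j
    using sym by (metis transpose_def vec_lambda_beta)
  have "\<exists>L. lower_triangular_pos L \<and> L ** transpose L = B S \<and>
      (\<forall>i j. i \<notin> S \<or> j \<notin> S \<longrightarrow> L $ i $ j = (if i = j then 1 else 0))" for S
  proof (induction S rule: finite_linorder_max_induct[OF finite])
    case 1
    have "B {} = mat 1" by (simp add: B_def mat_def)
    moreover have "lower_triangular_pos
        (mat 1 :: real ^ 'n::{finite,linorder} ^ 'n::{finite,linorder})"
      by (simp add: lower_triangular_pos_def mat_def)
    ultimately show ?case
      by (intro exI[of _ "mat 1"]) (simp add: transpose_mat, simp add: mat_def)
  next
    case (2 b S)
    then obtain L where L: "lower_triangular_pos L" "L ** transpose L = B S"
      and out: "\<And>i j. i \<notin> S \<or> j \<notin> S \<Longrightarrow> L $ i $ j = (if i = j then 1 else 0)"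
      by blast
    have b: "b \<notin> S" using 2 by auto
    \<comment> \<open>Bordering: the new row \<open>y\<close> must have inner product
      \<open>A $ i $ b\<close> with each old row \<open>i\<close> in \<open>S\<close>, which is the
      system \<open>L *v y = a\<close>.\<close>
    define a :: "real ^ 'n::{finite,linorder}" where "a = (\<chi> i. if i \<in> S then A $ i $ b else 0)"
    have inv: "invertible L" using L(1) by (rule lower_triangular_invertible)
    obtain y where y: "L *v y = a" using invertible_solve[OF inv] .
    have y_out: "y $ j = 0" if "j \<notin> S" for j
    proof -
      have "(L *v y) $ j = (\<Sum>k\<in>UNIV. if k = j then y $ k else 0)"
        unfolding matrix_vector_mult_def vec_lambda_beta
        by (rule sum.cong) (use out that in auto)
      then show ?thesis using that by (simp add: y a_def)
    qed
    \<comment> \<open>The induction adds an index \<open>b\<close> above all of \<open>S\<close>, so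
      placing \<open>y\<close> in row \<open>b\<close> keeps the factor lower triangular.\<close>
    have y_above: "y $ j = 0" if "b < j" for j
      using 2(2) that by (intro y_out) (auto dest: less_asym)
    \<comment> \<open>This \<open>x\<close> solves \<open>B S *v x = a\<close>. It is the vector
      that eliminates the new column, and it makes all mixed terms of the quadratic form equal to
      \<open>y \<bullet> y\<close>.\<close>
    have "invertible (transpose L)"
      using inv by (simp add: invertible_det_nz det_transpose)
    then obtain x where x: "transpose L *v x = y"
      using invertible_solve by blast
    have x_out: "x $ j = 0" if "j \<notin> S" for j
    proof -
      have "(transpose L *v x) $ j = (\<Sum>k\<in>UNIV. if k = j then x $ k else 0)"
        unfolding matrix_vector_mult_def vec_lambda_beta transpose_def
        by (rule sum.cong) (use out that in auto)
      then have "y $ j = x $ j" unfolding x by simp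
      then show ?thesis using y_out[OF that] by simp
    qed
    have xa: "x \<bullet> a = y \<bullet> y"
      using inner_matrix_vector_mult[of "transpose L" x y] unfolding x transpose_transpose y
      by simp
    \<comment> \<open>\<open>A\<close> and the padded matrix agree only on \<open>S\<close>; the
      factor \<open>x $ i\<close> discards the rows outside.\<close>
    have "x $ i * (A *v x) $ i = x $ i * (B S *v x) $ i" for i
    proof (cases "i \<in> S")
      case True
      then have "(A *v x) $ i = (B S *v x) $ i"
        unfolding matrix_vector_mult_def vec_lambda_beta B_def
        by (intro sum.cong) (auto simp: x_out)
      then show ?thesis by simp
    qed (simp add: x_out)
    then have AxS: "x \<bullet> (A *v x) = x \<bullet> (B S *v x)" by (simp only: inner_vec_def inner_real_def)
    have "x \<bullet> (B S *v x) = x \<bullet> (L *v (transpose L *v x))"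
      by (simp only: matrix_vector_mul_assoc L(2))
    also have "\<dots> = y \<bullet> y" by (simp only: x y xa)
    finally have xAx: "x \<bullet> (A *v x) = y \<bullet> y" using AxS by simp
    have Aax: "A *v axis b 1 = column b A"
      by (simp add: matrix_vector_mult_basis)
    have "x \<bullet> column b A = x \<bullet> a"
      unfolding inner_vec_def a_def column_def by (rule sum.cong) (auto simp: x_out)
    then have xAb: "x \<bullet> (A *v axis b 1) = y \<bullet> y" by (simp only: Aax xa)
    have bAx: "axis b 1 \<bullet> (A *v x) = y \<bullet> y"
      using inner_matrix_vector_mult[of A x "axis b 1"] unfolding sym xAb
      by (simp add: inner_commute)
    have bAb: "axis b 1 \<bullet> (A *v axis b 1) = A $ b $ b"
      by (simp add: Aax inner_axis' column_def)
    text \<open>The quadratic form at \<open>x - axis b 1\<close> is the Schur complement, i.e. the square of the new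
      pivot.\<close>
    have "(x - axis b 1) $ b \<noteq> 0" using x_out[OF b] by (simp add: axis_def)
    then have "x - axis b 1 \<noteq> 0" by (metis zero_index)
    from pos[OF this] have d: "0 < A $ b $ b - y \<bullet> y"
      by (simp add: matrix_vector_mult_diff_distrib inner_diff_left inner_diff_right
          xAx xAb bAx bAb)
    define d where "d = sqrt (A $ b $ b - y \<bullet> y)"
    define M where "M = (\<chi> i j. if i = b then if j = b then d else y $ j else L $ i $ j)"
    have row_b: "row b M = y + d *\<^sub>R axis b 1"
      using y_out[OF b] by (auto simp: vec_eq_iff row_def M_def axis_def)
    have row: "row i M = row i L" if "i \<noteq> b" for i
      using that by (simp add: vec_eq_iff row_def M_def)
    have row_L: "row i L \<bullet> y = a $ i" for i
      by (simp add: y[symmetric] matrix_vector_mult_def row_def inner_vec_def)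
    have cross: "row i L \<bullet> row b M = a $ i" if "i \<noteq> b" for i
      unfolding row_b inner_add_right row_L
      using out[of i b] b that by (simp add: inner_axis row_def)
    have diag: "row b M \<bullet> row b M = A $ b $ b"
      using d y_out[OF b] unfolding row_b
      by (simp add: inner_add_right inner_add_left inner_axis inner_axis' d_def)
    have LB: "row i L \<bullet> row j L = B S $ i $ j" for i j
      by (metis L(2) mult_transpose_nth)
    have "(M ** transpose M) $ i $ j = B (insert b S) $ i $ j" for i j
    proof (cases "i = b"; cases "j = b")
      assume "i = b" "j = b"
      then show ?thesis by (simp add: mult_transpose_nth diag B_def)
    next
      assume "i = b" "j \<noteq> b"
      then show ?thesis
        using cross[of j] b
        by (simp add: mult_transpose_nth row B_def a_def inner_commute symA)
    next
      assume "i \<noteq> b" "j = b"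
      then show ?thesis
        using cross[of i] b by (simp add: mult_transpose_nth row B_def a_def)
    next
      assume "i \<noteq> b" "j \<noteq> b"
      then show ?thesis by (simp add: mult_transpose_nth row LB B_def)
    qed
    then have "M ** transpose M = B (insert b S)" by (simp add: vec_eq_iff)
    moreover have "lower_triangular_pos M"
      using L(1) d y_above by (auto simp: lower_triangular_pos_def M_def d_def)
    moreover have "M $ i $ j = (if i = j then 1 else 0)"
      if "i \<notin> insert b S \<or> j \<notin> insert b S" for i j
      using that out[of i j] y_out[of j] by (auto simp: M_def)
    ultimately show ?case by blast
  qed
  moreover have "B UNIV = A" by (simp add: B_def)
  ultimately show ?thesis by (metis is_cholesky_iff)
qed

lemma cholesky_is_cholesky:
  fixes A :: "real ^ 'n::{finite,linorder} ^ 'n::{finite,linorder}"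
  assumes "transpose A = A" and "\<And>x. x \<noteq> 0 \<Longrightarrow> 0 < x \<bullet> (A *v x)"
  shows "is_cholesky A (cholesky A)"
  unfolding cholesky_def
  by (rule theI') (use cholesky_exists[OF assms] cholesky_unique in blast)

section \<open>Processing order of the coordinates and the unrolled iteration\<close>

lemma strict_mono_card_lessThan: "strict_mono (\<lambda>i::'n::{finite,linorder}. card {..<i})"
  by (intro strict_monoI psubset_card_mono) auto

text \<open>The predecessors of the entry at position \<open>k\<close> of the sorted list are
  exactly its first \<open>k\<close> entries, which are distinct.\<close>

lemma nth_index_card_lessThan: "nth_index (card {..<i}) = (i::'n::{finite,linorder})"
proof -
  let ?xs = "sorted_list_of_set (UNIV :: 'n set)"
  have xs: "sorted_wrt (<) ?xs" "set ?xs = UNIV"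
    by (simp_all add: strict_sorted_iff)
  obtain k where k: "k < length ?xs" "?xs ! k = i"
    using xs(2) by (metis UNIV_I in_set_conv_nth)
  have less: "?xs ! s < ?xs ! t" if "s < t" "t < length ?xs" for s t
    using sorted_wrt_nth_less[OF xs(1)] that by blast
  have "{..<i} = (!) ?xs ` {..<k}"
  proof (intro set_eqI iffI)
    fix j assume "j \<in> {..<i}"
    obtain s where s: "s < length ?xs" "?xs ! s = j"
      using xs(2) by (metis UNIV_I in_set_conv_nth)
    then have "s < k"
      using less[of k s] k \<open>j \<in> {..<i}\<close> by (metis lessThan_iff less_asym linorder_neqE_nat)
    then show "j \<in> (!) ?xs ` {..<k}" using s by auto
  qed (use less k in auto)
  moreover have "inj_on ((!) ?xs) {..<k}"
    using k(1) by (auto intro!: inj_on_nth)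
  ultimately have "card {..<i} = k" by (simp add: card_image)
  then show ?thesis using k by (simp add: nth_index_def)
qed

text \<open>The rank map is injective into a set of the same size, so every \<open>t\<close> below
  the dimension is the rank of some index.\<close>

lemma card_lessThan_nth_index:
  assumes "t < CARD('n::{finite,linorder})"
  shows "card {..<nth_index t :: 'n} = t"
proof -
  have "(\<lambda>i::'n. card {..<i}) ` UNIV \<subseteq> {..<CARD('n)}"
    by (auto intro!: psubset_card_mono)
  moreover have "card ((\<lambda>i::'n. card {..<i}) ` UNIV) = CARD('n)"
    using strict_mono_card_lessThan by (intro card_image strict_mono_imp_inj_on)
  ultimately have "(\<lambda>i::'n. card {..<i}) ` UNIV = {..<CARD('n)}"
    by (intro card_subset_eq) auto
  then obtain i :: 'n where "t = card {..<i}" using assms by (metis imageE lessThan_iff)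
  then show ?thesis by (simp add: nth_index_card_lessThan)
qed

text \<open>Here \<open>v i\<close> is the value of coordinate \<open>i\<close> at the moment it is
  quantized. Each step adds one term to every later coordinate, and its coefficient depends only on
  this frozen value.\<close>

lemma optq_iter_eq:
  fixes L :: "real ^ 'n::{finite,linorder} ^ 'n::{finite,linorder}" 
    and w :: "real ^ 'n::{finite,linorder}" and Q :: "real \<Rightarrow> real"
  defines "v \<equiv> \<lambda>i. optq_iter Q L w (card {..<i}) $ i"
  assumes "t \<le> CARD('n)"
  shows "optq_iter Q L w t $ j =
    w $ j + (\<Sum>i | card {..<i} < t \<and> i < j. L $ j $ i * ((Q (v i) - v i) / L $ i $ i))"
  using assms(2)
proof (induction t)
  case (Suc t)
  define i :: 'n where "i = nth_index t"
  have i: "card {..<i} = t"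
    using Suc.prems card_lessThan_nth_index[where t = t, where 'n = 'n] by (simp add: i_def)
  \<comment> \<open>Step \<open>t\<close> handles the only index of rank \<open>t\<close>, and it
    reaches coordinate \<open>j\<close> only if that index precedes \<open>j\<close>.\<close>
  have step: "{k. card {..<k} < Suc t \<and> k < j} =
      {k. card {..<k} < t \<and> k < j} \<union> (if i < j then {i} else {})"
    using i by (auto simp: less_Suc_eq i_def nth_index_card_lessThan)
  have "v i = optq_iter Q L w t $ i" by (simp add: v_def i)
  then show ?case
    using Suc i by (auto simp: Let_def i_def[symmetric] step)
qed simp

section \<open>Rounding errors and the quadratic form of the Hessian\<close>

lemma is_quantizer_error:
  assumes "is_quantizer \<delta> Q" and "0 < \<delta>"
  shows "\<bar>Q z - z\<bar> \<le> \<delta> / 2"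
proof -
  \<comment> \<open>At a tie \<open>Q z\<close> may differ from this witness, so distances are
    compared rather than points.\<close>
  let ?p = "of_int (round (z / \<delta>)) * \<delta>"
  have "?p \<in> alphabet \<delta>" by (auto simp: alphabet_def)
  then have "\<bar>z - Q z\<bar> \<le> \<bar>z - ?p\<bar>"
    using assms(1) unfolding is_quantizer_def is_arg_min_def by (meson not_le)
  also have "z - ?p = \<delta> * (z / \<delta> - of_int (round (z / \<delta>)))"
    using assms(2) by (simp add: field_simps)
  also have "\<bar>\<dots>\<bar> = \<delta> * \<bar>of_int (round (z / \<delta>)) - z / \<delta>\<bar>"
    using assms(2) by (simp add: abs_mult abs_minus_commute)
  also have "\<dots> \<le> \<delta> * (1 / 2)"
    using of_int_round_abs_le[of "z / \<delta>"] assms(2) by (intro mult_left_mono) auto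
  finally show ?thesis by (simp add: abs_minus_commute)
qed

text \<open>When \<open>j\<close> is quantized, all earlier indices have contributed, so
  \<open>v j - w $ j\<close> is the strictly lower part of row \<open>j\<close> of
  \<open>?L *v e\<close>. The rounding error \<open>Q (v j) - v j\<close> supplies the diagonal
  term.\<close>

lemma optq_error_factorization:
  fixes H :: "real ^ 'n::{finite,linorder} ^ 'n::{finite,linorder}"
  assumes "lower_triangular_pos (cholesky (matrix_inv H))" (is "lower_triangular_pos ?L")
    and "is_quantizer \<delta> Q" and "0 < \<delta>"
  obtains e where "optq Q H w - w = ?L *v e" and "\<And>i. \<bar>?L $ i $ i * e $ i\<bar> \<le> \<delta> / 2"
proof
  define v where "v i = optq_iter Q ?L w (card {..<i}) $ i" for i
  define e where "e = (\<chi> i. (Q (v i) - v i) / ?L $ i $ i)"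
  have e: "?L $ i $ i * e $ i = Q (v i) - v i" for i
    using assms(1) by (simp add: e_def lower_triangular_pos_def less_imp_neq[symmetric])
  have "v j = w $ j + (\<Sum>i | i < j. ?L $ j $ i * e $ i)" for j
  proof -
    have "{i. card {..<i} < card {..<j} \<and> i < j} = {i. i < j}"
      using strict_monoD[OF strict_mono_card_lessThan] by auto
    then show ?thesis
      using optq_iter_eq[of "card {..<j}" Q ?L w j] card_mono[of UNIV "{..<j}"]
      by (simp add: v_def e_def)
  qed
  then have "(?L *v e) $ j = Q (v j) - w $ j" for j
    by (simp add: lower_triangular_mult_nth[OF assms(1)] e)
  then show "optq Q H w - w = ?L *v e"
    by (simp add: vec_eq_iff optq_def v_def)
  show "\<bar>?L $ i $ i * e $ i\<bar> \<le> \<delta> / 2" for i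
    unfolding e using is_quantizer_error[OF assms(2,3)] .
qed

lemma inverse_diagonal_le:
  fixes L H :: "real ^ 'n::{finite,linorder} ^ 'n::{finite,linorder}"
  assumes L: "lower_triangular_pos L" and I: "transpose L ** H ** L = mat 1"
  shows "1 / (L $ j $ j)\<^sup>2 \<le> H $ j $ j"
proof -
  \<comment> \<open>This \<open>x\<close> is the \<open>j\<close>-th column of the inverse of
    \<open>L\<close>.\<close>
  obtain x where x: "L *v x = axis j 1"
    using invertible_solve[OF lower_triangular_invertible[OF L]] .
  have "L $ j $ j * x $ j = 1"
    using forward_substitution_leading[OF L, of j x] by (simp add: x axis_def)
  then have "1 / (L $ j $ j)\<^sup>2 = (x $ j)\<^sup>2"
    by (metis nonzero_eq_divide_eq one_neq_zero mult_zero_left mult.commute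
        power_one_over power_divide power_one)
  also have "\<dots> \<le> x \<bullet> x"
    unfolding inner_vec_def inner_real_def power2_eq_square[symmetric]
    by (rule member_le_sum) auto
  also have "x \<bullet> x = x \<bullet> ((transpose L ** H ** L) *v x)" by (simp add: I)
  also have "\<dots> = (L *v x) \<bullet> (H *v (L *v x))"
    by (simp add: inner_matrix_vector_mult matrix_vector_mul_assoc matrix_mul_assoc)
  also have "\<dots> = H $ j $ j"
    by (simp add: x matrix_vector_mult_basis inner_axis' column_def)
  finally show ?thesis .
qed

lemma optq_quadratic_error:
  fixes H :: "real ^ 'n::{finite,linorder} ^ 'n::{finite,linorder}"
    and w :: "real ^ 'n::{finite,linorder}"
  assumes sym: "transpose H = H" and pos: "\<And>x. x \<noteq> 0 \<Longrightarrow> 0 < x \<bullet> (H *v x)"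
    and Q: "is_quantizer \<delta> Q" "0 < \<delta>"
  defines "u \<equiv> optq Q H w - w"
  shows "u \<bullet> (H *v u) \<le> \<delta>\<^sup>2 / 4 * trace H"
proof -
  have "x = 0" if "H *v x = 0" for x
    using pos[of x] that by auto
  then have inv: "invertible H"
    unfolding invertible_left_inverse using matrix_left_invertible_ker by blast
  let ?A = "matrix_inv H"
  have HA: "H ** ?A = mat 1" and AH: "?A ** H = mat 1"
    using someI_ex[OF inv[unfolded invertible_def]] by (simp_all add: matrix_inv_def)
  have "transpose ?A ** H = mat 1"
    by (metis HA sym matrix_transpose_mul transpose_mat)
  then have symA: "transpose ?A = ?A"
    by (metis HA matrix_mul_assoc matrix_mul_lid matrix_mul_rid)
  \<comment> \<open>The form of the inverse at \<open>x\<close> is the form of \<open>H\<close> at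
    \<open>?A *v x\<close>.\<close>
  have posA: "0 < x \<bullet> (?A *v x)" if "x \<noteq> 0" for x
  proof -
    have x: "H *v (?A *v x) = x" by (simp add: matrix_vector_mul_assoc HA)
    then have "?A *v x \<noteq> 0" using that by auto
    from pos[OF this] show ?thesis by (simp add: x inner_commute)
  qed
  define L where "L = cholesky ?A"
  have chol: "?A = L ** transpose L" and L: "lower_triangular_pos L"
    using cholesky_is_cholesky[OF symA posA] by (auto simp: is_cholesky_iff L_def)
  have "L ** (transpose L ** H) = mat 1"
    using AH by (simp add: chol matrix_mul_assoc)
  \<comment> \<open>A one-sided inverse of a square matrix is two-sided, so the factor
    \<open>L\<close> may move to the other end.\<close>
  then have I: "transpose L ** H ** L = mat 1"
    by (simp add: matrix_left_right_inverse)
  obtain e where e: "u = L *v e" "\<And>i. \<bar>L $ i $ i * e $ i\<bar> \<le> \<delta> / 2"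
    using optq_error_factorization[OF L[unfolded L_def] Q] unfolding u_def L_def by metis
  have "u \<bullet> (H *v u) = e \<bullet> ((transpose L ** H ** L) *v e)"
    by (simp add: e(1) inner_matrix_vector_mult matrix_vector_mul_assoc matrix_mul_assoc)
  also have "\<dots> = (\<Sum>i\<in>UNIV. (e $ i)\<^sup>2)"
    by (simp add: I inner_vec_def power2_eq_square)
  also have "\<dots> \<le> (\<Sum>i\<in>UNIV. \<delta>\<^sup>2 / 4 * H $ i $ i)"
  proof (rule sum_mono)
    fix i
    have Li: "0 < L $ i $ i" using L by (simp add: lower_triangular_pos_def)
    have "(L $ i $ i * e $ i)\<^sup>2 \<le> (\<delta> / 2)\<^sup>2"
      using e(2)[of i] by (rule power2_le_iff_abs_le[THEN iffD2, rotated]) (use Q in auto)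
    then have "(e $ i)\<^sup>2 \<le> \<delta>\<^sup>2 / 4 * (1 / (L $ i $ i)\<^sup>2)"
      using Li by (simp add: field_simps power_mult_distrib)
    also have "\<dots> \<le> \<delta>\<^sup>2 / 4 * H $ i $ i"
      using inverse_diagonal_le[OF L I] by (intro mult_left_mono) auto
    finally show "(e $ i)\<^sup>2 \<le> \<delta>\<^sup>2 / 4 * H $ i $ i" .
  qed
  finally show ?thesis by (simp add: trace_def sum_distrib_left)
qed

section \<open>Trace against operator norm, and the final bounds\<close>

lemma trace_gram_le:
  fixes X :: "real ^ 'n ^ 'm"
  shows "trace (transpose X ** X) \<le> real CARD('n) * (onorm ((*v) X))\<^sup>2"
proof -
  have "(transpose X ** X) $ i $ i \<le> (onorm ((*v) X))\<^sup>2" for i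
  proof -
    \<comment> \<open>A diagonal Gram entry is the squared norm of a column, that is, of the image
      of a unit vector.\<close>
    have "(transpose X ** X) $ i $ i = (norm (X *v axis i 1))\<^sup>2"
      by (simp add: matrix_vector_mult_basis power2_norm_eq_inner matrix_matrix_mult_def
          transpose_def column_def inner_vec_def)
    also have "\<dots> \<le> (onorm ((*v) X))\<^sup>2"
      using onorm[OF matrix_vector_mul_bounded_linear, of X "axis i 1"]
      by (intro power_mono) auto
    finally show ?thesis .
  qed
  then have "trace (transpose X ** X) \<le> (\<Sum>i\<in>(UNIV :: 'n set). (onorm ((*v) X))\<^sup>2)"
    unfolding trace_def by (intro sum_mono)
  then show ?thesis by simp
qed

theorem corollary3p5:
  fixes X :: "real ^ 'n::{finite,linorder} ^ 'm::finite"
    and w q :: "real ^ 'n::{finite,linorder}"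
    and lam \<delta> :: real
    and Q :: "real \<Rightarrow> real"
  assumes "lam > 0" and "\<delta> > 0"
    and "is_quantizer \<delta> Q"
    and "q = optq Q (transpose X ** X + lam *\<^sub>R mat 1) w"
  shows "norm (X *v w - X *v q) \<le>
           sqrt (real CARD('n)) * \<delta> / 2 *
           min (sqrt (trace (transpose X ** X) / real CARD('n) + lam)) (onorm ((*v) X))
       \<and> norm (w - q) \<le>
           sqrt (real CARD('n)) * \<delta> / 2 *
           sqrt (trace (transpose X ** X) / (real CARD('n) * lam) + 1)"
proof -
  let ?N = "real CARD('n)" and ?T = "trace (transpose X ** X)"
  let ?H = "transpose X ** X + lam *\<^sub>R mat 1" and ?u = "q - w"
  have N: "0 < ?N" by simp
  have quad: "x \<bullet> (?H *v x) = (norm (X *v x))\<^sup>2 + lam * (norm x)\<^sup>2" for x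
  proof -
    have "x \<bullet> ((transpose X ** X) *v x) = (X *v x) \<bullet> (X *v x)"
      by (simp add: inner_matrix_vector_mult matrix_vector_mul_assoc)
    moreover have "(lam *\<^sub>R mat 1) *v x = lam *\<^sub>R x"
      by (simp add: scaleR_matrix_vector_assoc[symmetric])
    ultimately show ?thesis
      by (simp add: matrix_vector_mult_add_rdistrib inner_add_right power2_norm_eq_inner)
  qed
  have sym: "transpose ?H = ?H"
  proof -
    have "transpose (transpose X ** X) = transpose X ** X"
      by (simp add: matrix_transpose_mul)
    then show ?thesis
      by (auto simp: vec_eq_iff transpose_def mat_def)
  qed
  have pos: "0 < x \<bullet> (?H *v x)" if "x \<noteq> 0" for x
    unfolding quad using that assms(1) by (intro add_nonneg_pos) auto
  have trH: "trace ?H = ?T + ?N * lam"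
    by (simp add: trace_def mat_def sum.distrib)
  have main: "(norm (X *v ?u))\<^sup>2 + lam * (norm ?u)\<^sup>2 \<le> \<delta>\<^sup>2 / 4 * (?T + ?N * lam)"
    using optq_quadratic_error[OF sym pos assms(3,2), of w]
    unfolding quad trH assms(4)[symmetric] .
  \<comment> \<open>The largest norm of a vector whose entries are all at most
    \<open>\<delta> / 2\<close> in modulus. The \<open>lam\<close> part of the right side of
    \<open>main\<close> is exactly \<open>lam * ?c\<^sup>2\<close>, so \<open>?c\<close> is the
    threshold of the case split in \<open>b2\<close>.\<close>
  let ?c = "sqrt ?N * \<delta> / 2"
  have c: "0 \<le> ?c" "?c\<^sup>2 = ?N * \<delta>\<^sup>2 / 4"
    using assms(2) by (simp_all add: power_mult_distrib power_divide)
  have T: "0 \<le> ?T"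
    by (auto simp: trace_def matrix_matrix_mult_def transpose_def intro!: sum_nonneg)
  have b1: "norm (X *v ?u) \<le> ?c * sqrt (?T / ?N + lam)"
  proof (rule power2_le_imp_le)
    have "(norm (X *v ?u))\<^sup>2 \<le> \<delta>\<^sup>2 / 4 * (?T + ?N * lam)"
      using main mult_nonneg_nonneg[OF less_imp_le[OF assms(1)] zero_le_power2[of "norm ?u"]]
      by linarith
    also have "\<dots> = ?c\<^sup>2 * (?T / ?N + lam)"
      unfolding c by (simp add: field_simps)
    also have "\<dots> = (?c * sqrt (?T / ?N + lam))\<^sup>2"
    proof -
      have "0 \<le> ?T / ?N + lam" using T assms(1) by simp
      then show ?thesis unfolding power_mult_distrib[of ?c] by (simp only: real_sqrt_pow2)
    qed
    finally show "(norm (X *v ?u))\<^sup>2 \<le> (?c * sqrt (?T / ?N + lam))\<^sup>2" .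
  qed (use c T assms(1) in auto)
  have b2: "norm (X *v ?u) \<le> ?c * onorm ((*v) X)"
  proof (cases "norm ?u \<le> ?c")
    case True
    have "norm (X *v ?u) \<le> onorm ((*v) X) * norm ?u"
      by (rule onorm[OF matrix_vector_mul_bounded_linear])
    also have "\<dots> \<le> onorm ((*v) X) * ?c"
      using True by (intro mult_left_mono onorm_pos_le matrix_vector_mul_bounded_linear)
    finally show ?thesis by (simp add: mult.commute)
  next
    case False
    then have "lam * ?c\<^sup>2 \<le> lam * (norm ?u)\<^sup>2"
      using assms(1) c(1) by (intro mult_left_mono power_mono) auto
    then have "(norm (X *v ?u))\<^sup>2 \<le> \<delta>\<^sup>2 / 4 * ?T"
      using main unfolding c(2) by (simp add: algebra_simps)
    also have "\<dots> \<le> \<delta>\<^sup>2 / 4 * (?N * (onorm ((*v) X))\<^sup>2)"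
      using trace_gram_le[of X] by (intro mult_left_mono) auto
    also have "\<dots> = (?c * onorm ((*v) X))\<^sup>2"
      unfolding power_mult_distrib[of ?c] c(2) by simp
    finally show ?thesis
      by (rule power2_le_imp_le)
        (intro mult_nonneg_nonneg c(1) onorm_pos_le matrix_vector_mul_bounded_linear)
  qed
  have b3: "norm ?u \<le> ?c * sqrt (?T / (?N * lam) + 1)"
  proof (rule power2_le_imp_le)
    have "lam * (norm ?u)\<^sup>2 \<le> \<delta>\<^sup>2 / 4 * (?T + ?N * lam)"
      using main zero_le_power2[of "norm (X *v ?u)"] by linarith
    also have "\<dots> = lam * (?c\<^sup>2 * (?T / (?N * lam) + 1))"
      unfolding c using assms(1) by (simp add: field_simps)
    finally have "(norm ?u)\<^sup>2 \<le> ?c\<^sup>2 * (?T / (?N * lam) + 1)"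
      using assms(1) by simp
    also have "\<dots> = (?c * sqrt (?T / (?N * lam) + 1))\<^sup>2"
    proof -
      have "0 \<le> ?T / (?N * lam) + 1" using T assms(1) by simp
      then show ?thesis unfolding power_mult_distrib[of ?c] by (simp only: real_sqrt_pow2)
    qed
    finally show "(norm ?u)\<^sup>2 \<le> (?c * sqrt (?T / (?N * lam) + 1))\<^sup>2" .
  qed (use c T assms(1) in auto)
  have "norm (X *v w - X *v q) = norm (X *v ?u)"
    by (simp add: matrix_vector_mult_diff_distrib norm_minus_commute)
  then show ?thesis
    using b1 b2 b3 by (simp add: min_def norm_minus_commute)
qed

end
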